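(* Let $\alpha\in\mathbb{C}$ with $|\alpha|<1$, and let $\theta$ be a real number with $-\pi<\theta\le\pi$ and $|\theta|=\frac{2\pi q}{p}$ for integers $p\ge 1$, $q\ge 0$. Let $X_{\alpha,\theta}$ be the set of sums determined by all generalized revolving sequences with parameter $\theta$ (see context). Let $K_{\alpha,\theta}\subset\mathbb{C}$ be the self-similar set generated by the iterated function system $$\psi_1(z)=\alpha z,\qquad \psi_2(z)=(\alpha e^{i\theta})z+\alpha,$$ i.e. the unique nonempty compact set with $K_{\alpha,\theta}=\psi_1(K_{\alpha,\theta})\cup\psi_2(K_{\alpha,\theta})$. Then $$X_{\alpha,\theta}=\bigcup_{l=0}^{p-1}(e^{i\theta})^l K_{\alpha,\theta}.$$
   Context: $\mathbb{N}=\{1,2,3,\dots\}$. For $p,\theta$ as in the claim put $\Delta_\theta:=\{0,1,e^{i\theta},e^{2i\theta},\dots,e^{(p-1)i\theta}\}$. A sequence $(\delta_1,\delta_2,\dots)\in\Delta_\theta^{\mathbb{N}}$ satisfies the Generalized Revolving Condition (GRC) if, writing $n_1<n_2<\cdots$ for the (finite or infinite, possibly empty) list of indices $n$ with $\delta_n\neq 0$, one has $\delta_{n_{i+1}}=e^{i\theta}\delta_{n_i}$ for every pair of consecutive indices $n_i,n_{i+1}$ in the list (in the exponent $i$ is the imaginary unit; in the subscript it is an index). The first nonzero term may be any nonzero element of $\Delta_\theta$. The set of generalized revolving sequences is $W_\theta:=\{(\delta_n)\in\Delta_\theta^{\mathbb{N}}:(\delta_n)\text{ satisfies the GRC}\}$,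 and $$X_{\alpha,\theta}:=\left\{\sum_{n=1}^\infty\delta_n\alpha^n:(\delta_1,\delta_2,\dots)\in W_\theta\right\}.$$ For $c\in\mathbb{C}$ and $A\subset\mathbb{C}$, $cA:=\{ca:a\in A\}$. *)

theory Defs
  imports "HOL-Analysis.Analysis"
begin

definition digit_set :: "nat \<Rightarrow> real \<Rightarrow> complex set" where
  "digit_set p \<theta> = insert 0 {cis (real l * \<theta>) | l. l < p}"

text \<open>Sequences are indexed from 0, so \<open>\<delta> n\<close> is the term that is usually called \<open>\<delta>\<close> with
  subscript \<open>n + 1\<close>. The premise says that \<open>m\<close> and \<open>n\<close> are consecutive in the increasing list of
  the indices of nonzero terms.\<close>

definition GRC :: "real \<Rightarrow> (nat \<Rightarrow> complex) \<Rightarrow> bool" where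
  "GRC \<theta> \<delta> \<longleftrightarrow>
    (\<forall>m n. m < n \<and> \<delta> m \<noteq> 0 \<and> \<delta> n \<noteq> 0 \<and> (\<forall>k. m < k \<and> k < n \<longrightarrow> \<delta> k = 0)
       \<longrightarrow> \<delta> n = cis \<theta> * \<delta> m)"

definition revolving_seqs :: "nat \<Rightarrow> real \<Rightarrow> (nat \<Rightarrow> complex) set" where
  "revolving_seqs p \<theta> = {\<delta>. range \<delta> \<subseteq> digit_set p \<theta> \<and> GRC \<theta> \<delta>}"

text \<open>The series converges absolutely when \<open>norm \<alpha> < 1\<close>, since the digits are bounded.\<close>

definition revolving_sums :: "nat \<Rightarrow> complex \<Rightarrow> real \<Rightarrow> complex set" where
  "revolving_sums p \<alpha> \<theta> = {(\<Sum>n. \<delta> n * \<alpha> ^ Suc n) | \<delta>. \<delta> \<in> revolving_seqs p \<theta>}"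

text \<open>The attractor of an iterated function system \<open>F\<close>. It is meant for finite nonempty sets of
  contractions of a complete space, for which the described set exists and is unique (Hutchinson).\<close>

definition self_similar_set :: "('a::metric_space \<Rightarrow> 'a) set \<Rightarrow> 'a set" where
  "self_similar_set F = (THE K. K \<noteq> {} \<and> compact K \<and> K = (\<Union>f\<in>F. f ` K))"

definition psi1 :: "complex \<Rightarrow> complex \<Rightarrow> complex" where
  "psi1 \<alpha> z = \<alpha> * z"

definition psi2 :: "complex \<Rightarrow> real \<Rightarrow> complex \<Rightarrow> complex" where
  "psi2 \<alpha> \<theta> z = (\<alpha> * cis \<theta>) * z + \<alpha>"

definition K_set :: "complex \<Rightarrow> real \<Rightarrow> complex set" where
  "K_set \<alpha> \<theta> = self_similar_set {psi1 \<alpha>, psi2 \<alpha> \<theta>}"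

end

theory Submission
  imports Defs
begin

text \<open>
  Write \<open>w = cis \<theta>\<close>. Unfolding the invariance equation \<open>K = \<psi>\<^sub>1(K) \<union> \<psi>\<^sub>2(K)\<close> along an address
  \<open>x \<in> {0,1}\<^sup>\<nat>\<close>, where \<open>1\<close> stands for \<open>\<psi>\<^sub>2\<close>, yields the point \<open>\<Sum>n. d\<^sub>n \<alpha>\<^sup>n\<^sup>+\<^sup>1\<close> whose digit
  \<open>d\<^sub>n\<close> is \<open>x\<^sub>n\<close> times \<open>w\<close> to the number of ones among the earlier \<open>x\<^sub>k\<close>: each use of \<open>\<psi>\<^sub>2\<close> adds
  \<open>\<alpha>\<close> and turns everything further inside by \<open>w\<close>. These digit sequences are precisely the
  zero sequence and the revolving sequences whose first nonzero digit is \<open>1\<close>. Any other revolving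
  sequence is a power \<open>w\<^sup>l\<close>, its first nonzero digit, times such a sequence, and \<open>w\<^sup>p = 1\<close> reduces the exponent modulo \<open>p\<close>;
  hence the union of the rotated copies of \<open>K\<close>.

  That the set of address points really is the attractor has two parts. It is invariant because
  deleting the first letter of the address undoes one map, and it is compact as the continuous image
  of the Cantor space \<open>{0,1}\<^sup>\<nat>\<close> (\<open>K_set_eq_address_points\<close>). No other nonempty compact set is
  invariant: the largest distance from a point of one invariant set to another invariant set is
  contracted by the maps, so it is zero (\<open>invariant_compact_subset\<close>).
\<close>

section \<open>Uniqueness of the attractor of contractions\<close>

text \<open>A point of \<open>K\<close> farthest from \<open>L\<close> is \<open>f y\<close> with \<open>y \<in> K\<close>. The image under \<open>f\<close> of the point of
  \<open>L\<close> nearest to \<open>y\<close> lies in \<open>L\<close>, so the maximal distance is at most \<open>r\<close> times itself.\<close>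

lemma invariant_compact_subset:
  fixes F :: "('a::heine_borel \<Rightarrow> 'a) set"
  assumes r: "r < 1" and contr: "\<And>f x y. f \<in> F \<Longrightarrow> dist (f x) (f y) \<le> r * dist x y"
    and K: "compact K" "K \<subseteq> (\<Union>f\<in>F. f ` K)"
    and L: "L \<noteq> {}" "compact L" "(\<Union>f\<in>F. f ` L) \<subseteq> L"
  shows "K \<subseteq> L"
proof (cases "K = {}")
  case False
  have "continuous_on K (\<lambda>x. infdist x L)"
    by (intro continuous_intros)
  then obtain x where x: "x \<in> K" and max: "\<And>y. y \<in> K \<Longrightarrow> infdist y L \<le> infdist x L"
    using continuous_attains_sup[OF K(1) False] by metis
  obtain f y where f: "f \<in> F" and y: "y \<in> K" and xy: "x = f y"
    using x K(2) by blast
  have closed: "closed L"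
    using L(2) by (rule compact_imp_closed)
  obtain z where z: "z \<in> L" "infdist y L = dist y z"
    using infdist_attains_inf[OF closed L(1)] by metis
  have "f z \<in> L"
    using f z(1) L(3) by blast
  then have "infdist x L \<le> dist (f y) (f z)"
    unfolding xy by (rule infdist_le)
  also have "\<dots> \<le> r * dist y z"
    by (rule contr[OF f])
  finally have le: "infdist x L \<le> r * infdist y L"
    using z(2) by simp
  have "infdist x L \<le> 0"
  proof (cases "0 \<le> r")
    case True
    have "infdist x L \<le> r * infdist x L"
      using le mult_left_mono[OF max[OF y] True] by linarith
    then have "(1 - r) * infdist x L \<le> 0"
      by (simp add: algebra_simps)
    then show ?thesis
      using r by (simp add: mult_le_0_iff)
  next
    case False
    then have "r * infdist y L \<le> 0"
      by (simp add: mult_nonpos_nonneg infdist_nonneg)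
    with le show ?thesis
      by simp
  qed
  then have "infdist y L = 0" if "y \<in> K" for y
    using max[OF that] infdist_nonneg[of y L] by linarith
  then show ?thesis
    using in_closed_iff_infdist_zero[OF closed L(1)] by blast
qed simp

lemma self_similar_set_eqI:
  fixes F :: "('a::heine_borel \<Rightarrow> 'a) set"
  assumes r: "r < 1" and contr: "\<And>f x y. f \<in> F \<Longrightarrow> dist (f x) (f y) \<le> r * dist x y"
    and K: "K \<noteq> {}" "compact K" "K = (\<Union>f\<in>F. f ` K)"
  shows "self_similar_set F = K"
  unfolding self_similar_set_def
proof (rule the_equality)
  show "K \<noteq> {} \<and> compact K \<and> K = (\<Union>f\<in>F. f ` K)"
    by (intro conjI K)
next
  fix L assume "L \<noteq> {} \<and> compact L \<and> L = (\<Union>f\<in>F. f ` L)"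
  then have L: "L \<noteq> {}" "compact L" "L = (\<Union>f\<in>F. f ` L)"
    by blast+
  show "L = K"
    using invariant_compact_subset[OF r contr L(2) equalityD1[OF L(3)] K(1,2) equalityD2[OF K(3)]]
      invariant_compact_subset[OF r contr K(2) equalityD1[OF K(3)] L(1,2) equalityD2[OF L(3)]]
    by (rule equalityI)
qed

section \<open>Addresses and their digits\<close>

definition addresses :: "(nat \<Rightarrow> complex) set" where
  "addresses = (\<Pi>\<^sub>E n\<in>UNIV. {0, 1})"

text \<open>For \<open>x k \<in> {0, 1}\<close> the factor \<open>1 + x k * (w - 1)\<close> is \<open>w\<close> raised to the power \<open>x k\<close>. In this form
  every digit is a polynomial in the letters of the address, hence continuous in the address.\<close>

definition address_digit :: "complex \<Rightarrow> (nat \<Rightarrow> complex) \<Rightarrow> nat \<Rightarrow> complex" where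
  "address_digit w x n = x n * (\<Prod>k<n. 1 + x k * (w - 1))"

definition address_point :: "complex \<Rightarrow> complex \<Rightarrow> (nat \<Rightarrow> complex) \<Rightarrow> complex" where
  "address_point w \<alpha> x = (\<Sum>n. address_digit w x n * \<alpha> ^ Suc n)"

lemma addressesD: "x \<in> addresses \<Longrightarrow> x n = 0 \<or> x n = 1"
  by (auto simp: addresses_def PiE_iff)

lemma addressesI: "(\<And>n. x n = 0 \<or> x n = 1) \<Longrightarrow> x \<in> addresses"
  by (auto simp: addresses_def PiE_iff)

lemma compact_addresses: "compact addresses"
  using compactin_PiE[of "\<lambda>_::nat. euclidean :: complex topology" UNIV "\<lambda>_. {0, 1}"]
  by (simp add: addresses_def euclidean_product_topology)

lemma address_prod_eq_power:
  assumes "x \<in> addresses"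
  shows "\<exists>m. (\<Prod>k<n. 1 + x k * (w - 1)) = w ^ m"
proof (induction n)
  case 0
  have "(\<Prod>k<0. 1 + x k * (w - 1)) = w ^ 0"
    by simp
  then show ?case
    by blast
next
  case (Suc n)
  then obtain m where m: "(\<Prod>k<n. 1 + x k * (w - 1)) = w ^ m"
    by blast
  show ?case
  proof (cases "x n = 0")
    case True
    with m show ?thesis
      by auto
  next
    case False
    then have "x n = 1"
      using addressesD[OF assms] by blast
    with m have "(\<Prod>k<Suc n. 1 + x k * (w - 1)) = w ^ Suc m"
      by simp
    then show ?thesis
      by blast
  qed
qed

lemma address_digit_zero_or_power:
  assumes "x \<in> addresses"
  shows "address_digit w x n = 0 \<or> (\<exists>m. address_digit w x n = w ^ m)"
  using addressesD[OF assms, of n] address_prod_eq_power[OF assms, of w n]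
  by (auto simp: address_digit_def)

lemma address_digit_eq_0_iff:
  assumes "x \<in> addresses" and "norm w = 1"
  shows "address_digit w x n = 0 \<longleftrightarrow> x n = 0"
proof -
  have "w \<noteq> 0"
    using assms(2) by auto
  then have "(\<Prod>k<n. 1 + x k * (w - 1)) \<noteq> 0"
    using address_prod_eq_power[OF assms(1), of w n] by (metis power_not_zero)
  then show ?thesis
    unfolding address_digit_def by (simp only: mult_eq_0_iff simp_thms)
qed

lemma norm_address_digit_le:
  assumes "x \<in> addresses" and "norm w = 1"
  shows "norm (address_digit w x n) \<le> 1"
  using address_digit_zero_or_power[OF assms(1), of w n] assms(2)
  by (auto simp: norm_power)

lemma summable_address_point:
  assumes "x \<in> addresses" and "norm w = 1" and "norm \<alpha> < 1"
  shows "summable (\<lambda>n. address_digit w x n * \<alpha> ^ Suc n)"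
proof (rule summable_comparison_test')
  show "summable (\<lambda>n. norm \<alpha> ^ Suc n)"
    using assms(3) by (simp add: summable_mult)
  show "norm (address_digit w x n * \<alpha> ^ Suc n) \<le> norm \<alpha> ^ Suc n" for n
    unfolding norm_mult norm_power
    using mult_right_mono[OF norm_address_digit_le[OF assms(1,2), of n], of "norm \<alpha> ^ Suc n"]
    by simp
qed

section \<open>The set of address points is the attractor\<close>

text \<open>The digits are bounded by \<open>1\<close>, so the series converges uniformly in the address; its partial
  sums are polynomials in finitely many letters.\<close>

lemma continuous_on_address_point:
  assumes "norm w = 1" and "norm \<alpha> < 1"
  shows "continuous_on addresses (address_point w \<alpha>)"
  unfolding address_point_def
proof (rule uniform_limit_theorem)
  show "\<forall>\<^sub>F N in sequentially.
      continuous_on addresses (\<lambda>x. \<Sum>n<N. address_digit w x n * \<alpha> ^ Suc n)"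
    unfolding address_digit_def
    by (intro always_eventually allI continuous_intros continuous_on_product_coordinates
        continuous_on_subset[OF continuous_on_product_coordinates subset_UNIV])
  show "uniform_limit addresses (\<lambda>N x. \<Sum>n<N. address_digit w x n * \<alpha> ^ Suc n)
      (\<lambda>x. \<Sum>n. address_digit w x n * \<alpha> ^ Suc n) sequentially"
  proof (rule Weierstrass_m_test)
    show "norm (address_digit w x n * \<alpha> ^ Suc n) \<le> norm \<alpha> ^ Suc n" if "x \<in> addresses" for n x
      unfolding norm_mult norm_power
      using mult_right_mono[OF norm_address_digit_le[OF that assms(1), of n],
          of "norm \<alpha> ^ Suc n"]
      by simp
    show "summable (\<lambda>n. norm \<alpha> ^ Suc n)"
      using assms(2) by (simp add: summable_mult)
  qed
qed simp

text \<open>The first letter contributes \<open>x 0 * \<alpha>\<close>, and it scales the rest of the series by \<open>\<alpha>\<close> or by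
  \<open>w * \<alpha>\<close>. So prefixing an address with \<open>0\<close> applies \<open>\<psi>\<^sub>1\<close> to its point, and prefixing it with \<open>1\<close>
  applies \<open>\<psi>\<^sub>2\<close>.\<close>

lemma address_point_rec:
  assumes "x \<in> addresses" and "norm w = 1" and "norm \<alpha> < 1"
  shows "address_point w \<alpha> x
    = x 0 * \<alpha> + (1 + x 0 * (w - 1)) * \<alpha> * address_point w \<alpha> (\<lambda>n. x (Suc n))"
proof -
  have tail: "(\<lambda>n. x (Suc n)) \<in> addresses"
    using addressesD[OF assms(1)] by (intro addressesI)
  have digit_Suc: "address_digit w x (Suc n)
      = (1 + x 0 * (w - 1)) * address_digit w (\<lambda>n. x (Suc n)) n" for n
    unfolding address_digit_def prod.lessThan_Suc_shift by (simp add: mult_ac)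
  have "address_point w \<alpha> x
      = (\<Sum>n. address_digit w x (Suc n) * \<alpha> ^ Suc (Suc n)) + address_digit w x 0 * \<alpha> ^ Suc 0"
    unfolding address_point_def using suminf_split_head[OF summable_address_point[OF assms]]
    by simp
  also have "(\<Sum>n. address_digit w x (Suc n) * \<alpha> ^ Suc (Suc n))
      = (\<Sum>n. ((1 + x 0 * (w - 1)) * \<alpha>) * (address_digit w (\<lambda>n. x (Suc n)) n * \<alpha> ^ Suc n))"
    unfolding digit_Suc by (simp add: mult_ac)
  also have "\<dots> = (1 + x 0 * (w - 1)) * \<alpha> * address_point w \<alpha> (\<lambda>n. x (Suc n))"
    unfolding address_point_def
    by (rule suminf_mult[OF summable_address_point[OF tail assms(2,3)]])
  finally show ?thesis
    by (simp add: address_digit_def)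
qed

lemma psi_contraction:
  assumes "f \<in> {psi1 \<alpha>, psi2 \<alpha> \<theta>}"
  shows "dist (f x) (f y) \<le> norm \<alpha> * dist x y"
proof -
  have "dist (psi2 \<alpha> \<theta> x) (psi2 \<alpha> \<theta> y) = norm (\<alpha> * cis \<theta> * (x - y))"
    by (simp add: psi2_def dist_norm algebra_simps)
  moreover have "dist (psi1 \<alpha> x) (psi1 \<alpha> y) = norm (\<alpha> * (x - y))"
    by (simp add: psi1_def dist_norm algebra_simps)
  ultimately show ?thesis
    using assms by (auto simp: dist_norm norm_mult)
qed

lemma K_set_eq_address_points:
  assumes "norm \<alpha> < 1"
  shows "K_set \<alpha> \<theta> = address_point (cis \<theta>) \<alpha> ` addresses"
proof -
  let ?pt = "address_point (cis \<theta>) \<alpha>"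
  have nonempty: "?pt ` addresses \<noteq> {}"
    using addressesI[of "\<lambda>_. 0"] by auto
  have compact: "compact (?pt ` addresses)"
    using assms
    by (intro compact_continuous_image continuous_on_address_point compact_addresses) auto
  have invariant: "?pt ` addresses = (\<Union>f\<in>{psi1 \<alpha>, psi2 \<alpha> \<theta>}. f ` ?pt ` addresses)"
  proof (intro equalityI subsetI)
    fix z assume "z \<in> ?pt ` addresses"
    then obtain x where x: "x \<in> addresses" and z: "z = ?pt x"
      by blast
    have tail: "(\<lambda>n. x (Suc n)) \<in> addresses"
      using addressesD[OF x] by (intro addressesI)
    have "z = psi1 \<alpha> (?pt (\<lambda>n. x (Suc n))) \<or> z = psi2 \<alpha> \<theta> (?pt (\<lambda>n. x (Suc n)))"
      using addressesD[OF x, of 0] address_point_rec[OF x, of "cis \<theta>" \<alpha>] assms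
      by (auto simp: z psi1_def psi2_def mult_ac)
    with tail show "z \<in> (\<Union>f\<in>{psi1 \<alpha>, psi2 \<alpha> \<theta>}. f ` ?pt ` addresses)"
      by auto
  next
    fix z assume "z \<in> (\<Union>f\<in>{psi1 \<alpha>, psi2 \<alpha> \<theta>}. f ` ?pt ` addresses)"
    then obtain x where x: "x \<in> addresses" and z: "z = psi1 \<alpha> (?pt x) \<or> z = psi2 \<alpha> \<theta> (?pt x)"
      by auto
    have prefix: "case_nat c x \<in> addresses" if "c = 0 \<or> c = 1" for c
      using addressesD[OF x] that by (intro addressesI) (auto split: nat.split)
    have "z = ?pt (case_nat 0 x) \<or> z = ?pt (case_nat 1 x)"
      using z address_point_rec[OF prefix, of 0 "cis \<theta>" \<alpha>]
        address_point_rec[OF prefix, of 1 "cis \<theta>" \<alpha>] assms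
      by (auto simp: psi1_def psi2_def mult_ac)
    then show "z \<in> ?pt ` addresses"
      using prefix by blast
  qed
  show ?thesis
    unfolding K_set_def
    by (rule self_similar_set_eqI[OF assms psi_contraction nonempty compact invariant])
qed

section \<open>Revolving sequences as rotated address digits\<close>

lemma GRC_mult_left:
  assumes "GRC \<theta> \<delta>"
  shows "GRC \<theta> (\<lambda>n. c * \<delta> n)"
proof (cases "c = 0")
  case True
  then show ?thesis
    by (simp add: GRC_def)
next
  case False
  then have "GRC \<theta> (\<lambda>n. c * \<delta> n) \<longleftrightarrow> GRC \<theta> \<delta>"
    by (simp add: GRC_def mult.left_commute[of "cis \<theta>" c])
  with assms show ?thesis
    by simp
qed

text \<open>Between consecutive nonzero digits the product of turning factors gains exactly one factor
  different from \<open>1\<close>, namely the factor \<open>w\<close> of the earlier index.\<close>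

lemma GRC_address_digit:
  assumes x: "x \<in> addresses"
  shows "GRC \<theta> (address_digit (cis \<theta>) x)"
  unfolding GRC_def
proof (intro allI impI, elim conjE)
  fix m n
  let ?d = "address_digit (cis \<theta>) x" and ?t = "\<lambda>k. 1 + x k * (cis \<theta> - 1)"
  assume mn: "m < n" and nz: "?d m \<noteq> 0" "?d n \<noteq> 0"
    and gap: "\<forall>k. m < k \<and> k < n \<longrightarrow> ?d k = 0"
  have one: "x m = 1" "x n = 1"
    using nz addressesD[OF x] address_digit_eq_0_iff[OF x, of "cis \<theta>"] by auto
  have "prod ?t {..<n} = prod ?t {..<Suc m} * prod ?t {Suc m..<n}"
    using mn by (subst prod.union_disjoint[symmetric]) (auto intro!: prod.cong)
  also have "prod ?t {Suc m..<n} = 1"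
    using gap address_digit_eq_0_iff[OF x, of "cis \<theta>"] by (intro prod.neutral) auto
  finally show "?d n = cis \<theta> * ?d m"
    by (simp add: address_digit_def one)
qed

text \<open>The condition determines each nonzero term from the preceding one, so the support and the first
  nonzero term determine the sequence.\<close>

lemma GRC_unique:
  assumes "GRC \<theta> \<delta>" and "GRC \<theta> \<epsilon>"
    and supp: "\<And>n. \<delta> n = 0 \<longleftrightarrow> \<epsilon> n = 0"
    and first: "\<And>n. (\<And>k. k < n \<Longrightarrow> \<delta> k = 0) \<Longrightarrow> \<delta> n = \<epsilon> n"
  shows "\<delta> n = \<epsilon> n"
proof (induction n rule: less_induct)
  case (less n)
  show ?case
  proof (cases "\<delta> n = 0 \<or> (\<forall>k<n. \<delta> k = 0)")
    case True
    then show ?thesis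
      using supp[of n] first[of n] by auto
  next
    case False
    define S where "S = {k. k < n \<and> \<delta> k \<noteq> 0}"
    have S: "finite S" "S \<noteq> {}"
      using False by (auto simp: S_def)
    define m where "m = Max S"
    have m: "m < n" "\<delta> m \<noteq> 0"
      using Max_in[OF S] by (auto simp: m_def S_def)
    have gap: "\<delta> k = 0" if "m < k" "k < n" for k
    proof (rule ccontr)
      assume "\<delta> k \<noteq> 0"
      with that(2) have "k \<in> S"
        by (simp add: S_def)
      then have "k \<le> m"
        using Max_ge[OF S(1)] by (simp add: m_def)
      with that(1) show False
        by simp
    qed
    have "\<delta> n = cis \<theta> * \<delta> m"
      using assms(1) m gap False unfolding GRC_def by blast
    moreover have "\<epsilon> n = cis \<theta> * \<epsilon> m"
      using assms(2) m gap False supp unfolding GRC_def by blast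
    ultimately show ?thesis
      using less.IH[OF m(1)] by simp
  qed
qed

text \<open>The address of a revolving sequence is the indicator of its support, and \<open>cis \<theta> ^ l\<close> is its first
  nonzero digit; for the zero sequence any \<open>l < p\<close> serves. Conversely, the digits of a rotated address
  are arbitrary powers of \<open>cis \<theta>\<close>, which lie in the digit set because \<open>cis \<theta>\<close> is a \<open>p\<close>-th root of
  unity.\<close>

lemma revolving_seqs_eq_rotated_address_digits:
  assumes p: "p \<ge> 1" and root: "cis \<theta> ^ p = 1"
  shows "revolving_seqs p \<theta>
    = (\<Union>l<p. (\<lambda>x n. cis \<theta> ^ l * address_digit (cis \<theta>) x n) ` addresses)"
    (is "_ = ?R")
proof (intro equalityI subsetI)
  fix \<delta> assume "\<delta> \<in> revolving_seqs p \<theta>"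
  then have digits: "\<And>n. \<delta> n \<in> digit_set p \<theta>" and grc: "GRC \<theta> \<delta>"
    by (auto simp: revolving_seqs_def)
  define x where "x n = (if \<delta> n = 0 then 0 else 1 :: complex)" for n
  have x: "x \<in> addresses"
    by (rule addressesI) (simp add: x_def)
  have "\<exists>l<p. \<forall>n. \<delta> n \<noteq> 0 \<and> (\<forall>k<n. \<delta> k = 0) \<longrightarrow> \<delta> n = cis \<theta> ^ l"
  proof (cases "\<forall>n. \<delta> n = 0")
    case True
    with p show ?thesis
      by (intro exI[of _ 0]) auto
  next
    case False
    then obtain n0 where n0: "\<delta> n0 \<noteq> 0" "\<And>k. k < n0 \<Longrightarrow> \<delta> k = 0"
      using exists_least_iff[of "\<lambda>n. \<delta> n \<noteq> 0"] by blast
    obtain l where l: "l < p" "\<delta> n0 = cis \<theta> ^ l"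
      using digits[of n0] n0(1) by (auto simp: digit_set_def Complex.DeMoivre)
    have "n = n0" if "\<delta> n \<noteq> 0" "\<forall>k<n. \<delta> k = 0" for n
      using that n0 by (meson nat_neq_iff)
    with l show ?thesis
      by blast
  qed
  then obtain l where l: "l < p"
    and first: "\<And>n. \<delta> n \<noteq> 0 \<Longrightarrow> \<forall>k<n. \<delta> k = 0 \<Longrightarrow> \<delta> n = cis \<theta> ^ l"
    by blast
  have "\<delta> n = cis \<theta> ^ l * address_digit (cis \<theta>) x n" for n
  proof (rule GRC_unique[OF grc GRC_mult_left[OF GRC_address_digit[OF x]]])
    show "\<delta> n = 0 \<longleftrightarrow> cis \<theta> ^ l * address_digit (cis \<theta>) x n = 0" for n
      using address_digit_eq_0_iff[OF x, of "cis \<theta>" n] by (simp add: x_def)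
    show "\<delta> n = cis \<theta> ^ l * address_digit (cis \<theta>) x n" if "\<And>k. k < n \<Longrightarrow> \<delta> k = 0" for n
    proof -
      have "(\<Prod>k<n. 1 + x k * (cis \<theta> - 1)) = 1"
        using that by (intro prod.neutral) (simp add: x_def)
      then show ?thesis
        using first[of n] that by (auto simp: address_digit_def x_def)
    qed
  qed
  then have "\<delta> = (\<lambda>n. cis \<theta> ^ l * address_digit (cis \<theta>) x n)"
    by (rule ext)
  with l x show "\<delta> \<in> ?R"
    by (intro UN_I[of l] image_eqI[of _ _ x]) simp_all
next
  fix \<delta> assume "\<delta> \<in> ?R"
  then obtain l x where x: "x \<in> addresses"
    and \<delta>: "\<delta> = (\<lambda>n. cis \<theta> ^ l * address_digit (cis \<theta>) x n)"
    by blast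
  have power: "cis \<theta> ^ m \<in> digit_set p \<theta>" for m
  proof -
    have "cis \<theta> ^ m = cis \<theta> ^ (p * (m div p) + m mod p)"
      by simp
    also have "\<dots> = cis \<theta> ^ (m mod p)"
      unfolding power_add power_mult root by simp
    also have "\<dots> = cis (real (m mod p) * \<theta>)"
      by (rule Complex.DeMoivre)
    finally show ?thesis
      using p by (auto simp: digit_set_def)
  qed
  have "\<delta> n \<in> digit_set p \<theta>" for n
    using address_digit_zero_or_power[OF x, of "cis \<theta>" n]
  proof
    assume "address_digit (cis \<theta>) x n = 0"
    then show ?thesis
      by (simp add: \<delta> digit_set_def)
  next
    assume "\<exists>m. address_digit (cis \<theta>) x n = cis \<theta> ^ m"
    then obtain m where "\<delta> n = cis \<theta> ^ (l + m)"
      by (auto simp: \<delta> power_add)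
    with power show ?thesis
      by simp
  qed
  moreover have "GRC \<theta> \<delta>"
    unfolding \<delta> by (intro GRC_mult_left GRC_address_digit x)
  ultimately show "\<delta> \<in> revolving_seqs p \<theta>"
    by (auto simp: revolving_seqs_def)
qed

lemma cis_power_eq_1:
  assumes "p \<ge> 1" and "\<bar>\<theta>\<bar> = 2 * pi * real q / real p"
  shows "cis \<theta> ^ p = 1"
proof -
  have abs_eq: "real p * \<bar>\<theta>\<bar> = 2 * pi * real q"
    using assms by (simp add: field_simps)
  have "real p * \<theta> = 2 * pi * (if \<theta> < 0 then - real q else real q)"
    using abs_eq by (cases "\<theta> < 0") simp_all
  moreover have "(if \<theta> < 0 then - real q else real q) \<in> \<int>"
    by simp
  ultimately show ?thesis
    by (simp only: Complex.DeMoivre cis_multiple_2pi)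
qed

section \<open>The sums of revolving sequences\<close>

theorem theorem1p2:
  fixes \<alpha> :: complex and \<theta> :: real and p q :: nat
  assumes "norm \<alpha> < 1"
    and "- pi < \<theta>" and "\<theta> \<le> pi"
    and "p \<ge> 1"
    and "\<bar>\<theta>\<bar> = 2 * pi * real q / real p"
  shows "revolving_sums p \<alpha> \<theta> = (\<Union>l<p. (\<lambda>z. cis \<theta> ^ l * z) ` K_set \<alpha> \<theta>)"
proof -
  let ?w = "cis \<theta>"
  have factor: "(\<Sum>n. ?w ^ l * address_digit ?w x n * \<alpha> ^ Suc n) = ?w ^ l * address_point ?w \<alpha> x"
    if "x \<in> addresses" for l x
    using suminf_mult[OF summable_address_point[OF that _ assms(1)], of ?w "?w ^ l"]
    by (simp add: address_point_def mult.assoc)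
  have "revolving_sums p \<alpha> \<theta> = (\<lambda>\<delta>. \<Sum>n. \<delta> n * \<alpha> ^ Suc n) ` revolving_seqs p \<theta>"
    by (auto simp: revolving_sums_def)
  also have "\<dots> = (\<Union>l<p. (\<lambda>x. \<Sum>n. ?w ^ l * address_digit ?w x n * \<alpha> ^ Suc n) ` addresses)"
    unfolding revolving_seqs_eq_rotated_address_digits[OF assms(4) cis_power_eq_1[OF assms(4,5)]]
      image_UN image_image ..
  also have "\<dots> = (\<Union>l<p. (\<lambda>x. ?w ^ l * address_point ?w \<alpha> x) ` addresses)"
    by (intro SUP_cong image_cong refl factor)
  also have "\<dots> = (\<Union>l<p. (\<lambda>z. ?w ^ l * z) ` address_point ?w \<alpha> ` addresses)"
    unfolding image_image ..
  finally show ?thesis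
    unfolding K_set_eq_address_points[OF assms(1)] .
qed

end
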